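(* For all $(i,j,t,\overleftarrow{t})\in\overleftarrow{\mathcal{E}}$, the overlapping time $\sigma_{ij}^{t\overleftarrow{t}}$ between the braking phase of $t$ on platform $i$ and the accelerating phase of $\overleftarrow{t}$ on platform $j$, where $(i,j)\in\Omega$, can be modelled by the following robust formulation: $$a_i^t - d_j^{\overleftarrow{t}} + \epsilon \leq \underline{\alpha}_j^{\overleftarrow{t}} + \underline{\beta}_i^t + M(1 - \lambda_{ij}^{t\overleftarrow{t}}),$$ $$d_j^{\overleftarrow{t}} - a_i^t + \epsilon \leq M(1 - \lambda_{ij}^{t\overleftarrow{t}}),$$ $$\sigma_{ij}^{t\overleftarrow{t}} \geq 0,$$ $$\sigma_{ij}^{t\overleftarrow{t}} \leq \underline{\alpha}_j^{\overleftarrow{t}} \lambda_{ij}^{t\overleftarrow{t}},$$ $$\sigma_{ij}^{t\overleftarrow{t}} \leq \underline{\beta}_i^t \lambda_{ij}^{t\overleftarrow{t}},$$ $$\sigma_{ij}^{t\overleftarrow{t}} \leq d_j^{\overleftarrow{t}} - a_i^t + \underline{\alpha}_j^{\overleftarrow{t}} + \underline{\beta}_i^t + M(1 - \lambda_{ij}^{t\overleftarrow{t}}),$$ $$\sigma_{ij}^{t\overleftarrow{t}} \leq a_i^t - d_j^{\overleftarrow{t}} + M(1 - \lambda_{ij}^{t\overleftarrow{t}}),$$ where $M$ is a large positive number, $\epsilon$ is a small positive number smaller than the time granularity considered, and $\lambda_{ij}^{t\overleftarrow{t}}$ is a binary variable which is one if and only if $\sigma_{ij}^{t\overleftarrow{t}}$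 is positive.
   Context: Railway setting. $\mathcal{N}$ is the finite set of platforms and $\mathcal{T}$ the finite set of trains of a railway network. For a train $t$, $\mathcal{N}^t\subseteq\mathcal{N}$ is the set of platforms it visits, and $\mathcal{T}_i\subseteq\mathcal{T}$ is the set of all trains which arrive at, dwell at and then depart from platform $i$. $\Omega$ is the set of platform pairs that are opposite to each other and powered by the same electrical substation. The decision variables $a_i^t$ and $d_i^t$ are the arrival time of train $t$ at platform $i$ and its departure time from platform $i$. An initial feasible timetable is given, with arrival times $\bar a_i^t$ and departure times $\bar d_i^t$. Temporally closest trains. Let $r$ be an empirical parameter chosen by the timetable designer, much smaller than the time horizon of the entire timetable. For $(i,j)\in\Omega$ and $t\in\mathcal{T}_i$, write $m_i^t=\frac{\bar a_i^t+\bar d_i^t}{2}$ (and likewise $m_j^x$ for $x\in\mathcal{T}_j$). The temporally closest train to the right of $t$, denoted $\overrightarrow{t}\in\mathcal{T}_j$, is the minimizer of $|m_i^t-m_j^{t'}|$ over $t'\in\{x\in\mathcal{T}_j: 0\le m_j^x-m_i^t\le r\}$. The temporally closest train to the left of $t$, denoted $\overleftarrow{t}\in\mathcal{T}_j$, is the minimizer of $|m_i^t-m_j^{t'}|$ over $t'\in\{x\in\mathcal{T}_j: 0< m_i^t-m_j^x\le r\}$. The temporally closest train $\tilde t$ to $t$ is the minimizer of $|m_i^t-m_j^{t'}|$ over $t'\in\{\overrightarrow{t},\overleftarrow{t}\}$, one of them being picked arbitrarily if both are equidistant from $t$. $\mathcal{E}$ is the set of all tuples $(i,j,t,\tilde t)$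 so obtained; it is partitioned into $\overrightarrow{\mathcal{E}}$ (tuples of the form $(i,j,t,\overrightarrow{t})$) and $\overleftarrow{\mathcal{E}}$ (tuples of the form $(i,j,t,\overleftarrow{t})$). Braking and accelerating phases. $a_i^{t-}$ is the start of the braking phase of train $t$ before arriving at platform $i$ (the phase ends at $a_i^t$), and $d_i^{t+}$ is the end of its accelerating phase after departing from platform $i$ (the phase starts at $d_i^t$). The durations are $\beta_i^t=a_i^t-a_i^{t-}$ and $\alpha_i^t=d_i^{t+}-d_i^t$. They depend on the trip time, which is not known in advance, but lie within known bounds $\alpha_i^t\in[\underline{\alpha}_i^t,\overline{\alpha}_i^t]$ and $\beta_i^t\in[\underline{\beta}_i^t,\overline{\beta}_i^t]$, so that $a_i^{t-}\in[a_i^t-\overline{\beta}_i^t,a_i^t-\underline{\beta}_i^t]$ and $d_i^{t+}\in[d_i^t+\underline{\alpha}_i^t,d_i^t+\overline{\alpha}_i^t]$. The same notation is used for every train and platform. The formulation is called robust because it is meant to account for all $a_i^{t-}$ and $d_j^{\overleftarrow{t}+}$ in the corresponding intervals. Overlapping time. For given phases, the overlapping time of the accelerating phase of $\overleftarrow{t}$ on platform $j$ and the braking phase of $t$ on platform $i$ is $0$ if $a_i^{t-}\ge d_j^{\overleftarrow{t}+}$ or $a_i^{t}\le d_j^{\overleftarrow{t}}$, and is $\min\{d_j^{\overleftarrow{t}+},a_i^{t}\}-\max\{d_j^{\overleftarrow{t}},a_i^{t-}\}$ otherwise. It is modelled by the hypograph approach, i.e. by upper bounds on the variable $\sigma_{ij}^{t\overleftarrow{t}}$,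 within an optimization problem whose objective is to maximize the sum of the overlapping times over all elements of $\overrightarrow{\mathcal{E}}$ and $\overleftarrow{\mathcal{E}}$. *)

theory Defs
  imports Complex_Main
begin

text \<open>
  Platform-indexed, train-indexed data: \<open>a i t\<close> is the quantity for train \<open>t\<close> at platform \<open>i\<close>.
  \<open>trains_at N i\<close> are the trains that arrive at, dwell at and depart from \<open>i\<close>, which may be fewer
  than the trains visiting \<open>i\<close>; \<open>opposite N\<close> is the set of pairs of platforms that are opposite to
  each other and powered by the same substation; \<open>arr0\<close>, \<open>dep0\<close> is the initial timetable.
\<close>

record ('n, 't) railway =
  platforms :: "'n set"
  trains :: "'t set"
  visits :: "'t \<Rightarrow> 'n set"
  trains_at :: "'n \<Rightarrow> 't set"
  opposite :: "('n \<times> 'n) set"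
  horizon :: real
  granularity :: real
  radius :: real
  arr0 :: "'n \<Rightarrow> 't \<Rightarrow> real"
  dep0 :: "'n \<Rightarrow> 't \<Rightarrow> real"
  acc_lo :: "'n \<Rightarrow> 't \<Rightarrow> real"
  acc_up :: "'n \<Rightarrow> 't \<Rightarrow> real"
  brk_lo :: "'n \<Rightarrow> 't \<Rightarrow> real"
  brk_up :: "'n \<Rightarrow> 't \<Rightarrow> real"

definition on_grid :: "real \<Rightarrow> real \<Rightarrow> bool" where
  "on_grid g x \<longleftrightarrow> (\<exists>k::int. x = of_int k * g)"

text \<open>
  The minimal durations are on the time grid like all event times: the strict inequality
  \<open>a - d < acc_lo + brk_lo\<close> is encoded with the slack \<open>\<epsilon>\<close>, which is exact only if both of its sides
  are multiples of the granularity.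
\<close>

definition wf_railway :: "('n, 't) railway \<Rightarrow> bool" where
  "wf_railway N \<longleftrightarrow>
     finite (platforms N) \<and> finite (trains N) \<and>
     (\<forall>t \<in> trains N. visits N t \<subseteq> platforms N) \<and>
     (\<forall>i \<in> platforms N. trains_at N i \<subseteq> {t \<in> trains N. i \<in> visits N t}) \<and>
     opposite N \<subseteq> platforms N \<times> platforms N \<and>
     0 < granularity N \<and> radius N < horizon N \<and>
     (\<forall>i \<in> platforms N. \<forall>t \<in> trains_at N i.
        0 \<le> acc_lo N i t \<and> acc_lo N i t \<le> acc_up N i t \<and> on_grid (granularity N) (acc_lo N i t) \<and>
        0 \<le> brk_lo N i t \<and> brk_lo N i t \<le> brk_up N i t \<and> on_grid (granularity N) (brk_lo N i t))"

definition midpoint0 :: "('n, 't) railway \<Rightarrow> 'n \<Rightarrow> 't \<Rightarrow> real" where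
  "midpoint0 N i t = (arr0 N i t + dep0 N i t) / 2"

definition closest_right :: "('n, 't) railway \<Rightarrow> 'n \<Rightarrow> 'n \<Rightarrow> 't \<Rightarrow> 't \<Rightarrow> bool" where
  "closest_right N i j t = is_arg_min (\<lambda>x. \<bar>midpoint0 N i t - midpoint0 N j x\<bar>)
     (\<lambda>x. x \<in> trains_at N j \<and> 0 \<le> midpoint0 N j x - midpoint0 N i t \<and>
          midpoint0 N j x - midpoint0 N i t \<le> radius N)"

definition closest_left :: "('n, 't) railway \<Rightarrow> 'n \<Rightarrow> 'n \<Rightarrow> 't \<Rightarrow> 't \<Rightarrow> bool" where
  "closest_left N i j t = is_arg_min (\<lambda>x. \<bar>midpoint0 N i t - midpoint0 N j x\<bar>)
     (\<lambda>x. x \<in> trains_at N j \<and> 0 < midpoint0 N i t - midpoint0 N j x \<and>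
          midpoint0 N i t - midpoint0 N j x \<le> radius N)"

definition closest :: "('n, 't) railway \<Rightarrow> 'n \<Rightarrow> 'n \<Rightarrow> 't \<Rightarrow> 't \<Rightarrow> bool" where
  "closest N i j t = is_arg_min (\<lambda>x. \<bar>midpoint0 N i t - midpoint0 N j x\<bar>)
     (\<lambda>x. closest_right N i j t x \<or> closest_left N i j t x)"

type_synonym ('n, 't) event_pair = "'n \<times> 'n \<times> 't \<times> 't"

text \<open>
  \<open>E\<close> arises by picking, arbitrarily in case of ties, one closest train for every \<open>(i, j)\<close> and \<open>t\<close>
  for which there is one.
\<close>

definition closest_pairs :: "('n, 't) railway \<Rightarrow> ('n, 't) event_pair set \<Rightarrow> bool" where
  "closest_pairs N E \<longleftrightarrow>
     (\<forall>(i, j, t, x) \<in> E. (i, j) \<in> opposite N \<and> t \<in> trains_at N i \<and> closest N i j t x) \<and>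
     (\<forall>(i, j) \<in> opposite N. \<forall>t \<in> trains_at N i.
        (\<exists>x. closest N i j t x) \<longrightarrow> (\<exists>!x. (i, j, t, x) \<in> E))"

definition right_pairs ::
  "('n, 't) railway \<Rightarrow> ('n, 't) event_pair set \<Rightarrow> ('n, 't) event_pair set" where
  "right_pairs N E = {(i, j, t, x) \<in> E. closest_right N i j t x}"

definition left_pairs ::
  "('n, 't) railway \<Rightarrow> ('n, 't) event_pair set \<Rightarrow> ('n, 't) event_pair set" where
  "left_pairs N E = {(i, j, t, x) \<in> E. closest_left N i j t x}"

lemma right_left_partition:
  assumes "closest_pairs N E"
  shows "right_pairs N E \<union> left_pairs N E = E" "right_pairs N E \<inter> left_pairs N E = {}"
proof -
  have "closest_right N i j t x \<or> closest_left N i j t x" if "(i, j, t, x) \<in> E" for i j t x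
    using that assms unfolding closest_pairs_def closest_def is_arg_min_def by blast
  then show "right_pairs N E \<union> left_pairs N E = E"
    unfolding right_pairs_def left_pairs_def by auto
  have "\<not> (closest_right N i j t x \<and> closest_left N i j t x)" for i j t x
    unfolding closest_right_def closest_left_def is_arg_min_def by linarith
  then show "right_pairs N E \<inter> left_pairs N E = {}"
    unfolding right_pairs_def left_pairs_def by auto
qed

text \<open>
  Overlapping time of the accelerating phase from \<open>d\<close> to \<open>dp\<close> and the braking phase from \<open>am\<close> to \<open>a\<close>.
\<close>

definition overlap :: "real \<Rightarrow> real \<Rightarrow> real \<Rightarrow> real \<Rightarrow> real" where
  "overlap d dp am a = (if am \<ge> dp \<or> a \<le> d then 0 else min dp a - max d am)"

text \<open>
  All pairs (start of the braking phase of \<open>t\<close> on \<open>i\<close>, end of the accelerating phase of \<open>x\<close> on \<open>j\<close>)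
  compatible with the bounds on the durations of the phases.
\<close>

fun phase_box ::
  "('n, 't) railway \<Rightarrow> ('n \<Rightarrow> 't \<Rightarrow> real) \<Rightarrow> ('n \<Rightarrow> 't \<Rightarrow> real) \<Rightarrow> ('n, 't) event_pair
     \<Rightarrow> (real \<times> real) set" where
  "phase_box N a d (i, j, t, x) =
     {a i t - brk_up N i t .. a i t - brk_lo N i t} \<times> {d j x + acc_lo N j x .. d j x + acc_up N j x}"

fun robust_hypograph ::
  "('n, 't) railway \<Rightarrow> ('n \<Rightarrow> 't \<Rightarrow> real) \<Rightarrow> ('n \<Rightarrow> 't \<Rightarrow> real) \<Rightarrow> ('n, 't) event_pair \<Rightarrow> real
     \<Rightarrow> bool" where
  "robust_hypograph N a d (i, j, t, x) \<sigma> \<longleftrightarrow>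
     0 \<le> \<sigma> \<and> (\<forall>(am, dp) \<in> phase_box N a d (i, j, t, x). \<sigma> \<le> overlap (d j x) dp am (a i t))"

fun worst_overlap ::
  "('n, 't) railway \<Rightarrow> ('n \<Rightarrow> 't \<Rightarrow> real) \<Rightarrow> ('n \<Rightarrow> 't \<Rightarrow> real) \<Rightarrow> ('n, 't) event_pair \<Rightarrow> real" where
  "worst_overlap N a d (i, j, t, x) =
     (INF (am, dp) \<in> phase_box N a d (i, j, t, x). overlap (d j x) dp am (a i t))"

fun robust_formulation ::
  "('n, 't) railway \<Rightarrow> real \<Rightarrow> real \<Rightarrow> ('n \<Rightarrow> 't \<Rightarrow> real) \<Rightarrow> ('n \<Rightarrow> 't \<Rightarrow> real) \<Rightarrow> ('n, 't) event_pair
     \<Rightarrow> real \<Rightarrow> real \<Rightarrow> bool" where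
  "robust_formulation N M \<epsilon> a d (i, j, t, x) \<sigma> lam \<longleftrightarrow>
     lam \<in> {0, 1} \<and>
     a i t - d j x + \<epsilon> \<le> acc_lo N j x + brk_lo N i t + M * (1 - lam) \<and>
     d j x - a i t + \<epsilon> \<le> M * (1 - lam) \<and>
     \<sigma> \<ge> 0 \<and>
     \<sigma> \<le> acc_lo N j x * lam \<and>
     \<sigma> \<le> brk_lo N i t * lam \<and>
     \<sigma> \<le> d j x - a i t + acc_lo N j x + brk_lo N i t + M * (1 - lam) \<and>
     \<sigma> \<le> a i t - d j x + M * (1 - lam)"

text \<open>
  A set \<open>X\<close> of triples \<open>(a, d, \<rho>)\<close> stands for the remaining constraints of the optimization problem,
  on the timetable \<open>(a, d)\<close> and on the overlapping times \<open>\<rho>\<close> of the pairs in \<open>right_pairs N E\<close>.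
\<close>

type_synonym ('n, 't) partial_solution =
  "('n \<Rightarrow> 't \<Rightarrow> real) \<times> ('n \<Rightarrow> 't \<Rightarrow> real) \<times> (('n, 't) event_pair \<Rightarrow> real)"

definition timetable_constraints ::
  "('n, 't) railway \<Rightarrow> ('n, 't) partial_solution set \<Rightarrow> bool" where
  "timetable_constraints N X \<longleftrightarrow>
     (\<exists>\<rho>. (arr0 N, dep0 N, \<rho>) \<in> X) \<and>
     (\<forall>(a, d, \<rho>) \<in> X. \<forall>i \<in> platforms N. \<forall>t \<in> trains_at N i.
        a i t \<in> {0..horizon N} \<and> on_grid (granularity N) (a i t) \<and>
        d i t \<in> {0..horizon N} \<and> on_grid (granularity N) (d i t))"

type_synonym ('n, 't) solution =
  "('n, 't) partial_solution \<times> (('n, 't) event_pair \<Rightarrow> real)"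

definition total_overlap ::
  "('n, 't) railway \<Rightarrow> ('n, 't) event_pair set \<Rightarrow> ('n, 't) solution \<Rightarrow> real" where
  "total_overlap N E = (\<lambda>((a, d, \<rho>), \<sigma>). (\<Sum>e \<in> right_pairs N E. \<rho> e) + (\<Sum>e \<in> left_pairs N E. \<sigma> e))"

definition robust_feasible ::
  "('n, 't) railway \<Rightarrow> ('n, 't) event_pair set \<Rightarrow> ('n, 't) partial_solution set
     \<Rightarrow> ('n, 't) solution \<Rightarrow> bool" where
  "robust_feasible N E X = (\<lambda>((a, d, \<rho>), \<sigma>).
     (a, d, \<rho>) \<in> X \<and> (\<forall>e \<in> left_pairs N E. robust_hypograph N a d e (\<sigma> e)))"

definition mip_feasible ::
  "('n, 't) railway \<Rightarrow> ('n, 't) event_pair set \<Rightarrow> ('n, 't) partial_solution set \<Rightarrow> real \<Rightarrow> real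
     \<Rightarrow> ('n, 't) solution \<times> (('n, 't) event_pair \<Rightarrow> real) \<Rightarrow> bool" where
  "mip_feasible N E X M \<epsilon> = (\<lambda>(((a, d, \<rho>), \<sigma>), lam).
     (a, d, \<rho>) \<in> X \<and> (\<forall>e \<in> left_pairs N E. robust_formulation N M \<epsilon> a d e (\<sigma> e) (lam e)))"

definition robust_optimal ::
  "('n, 't) railway \<Rightarrow> ('n, 't) event_pair set \<Rightarrow> ('n, 't) partial_solution set
     \<Rightarrow> ('n, 't) solution \<Rightarrow> bool" where
  "robust_optimal N E X = is_arg_max (total_overlap N E) (robust_feasible N E X)"

definition mip_optimal ::
  "('n, 't) railway \<Rightarrow> ('n, 't) event_pair set \<Rightarrow> ('n, 't) partial_solution set \<Rightarrow> real \<Rightarrow> real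
     \<Rightarrow> ('n, 't) solution \<times> (('n, 't) event_pair \<Rightarrow> real) \<Rightarrow> bool" where
  "mip_optimal N E X M \<epsilon> = is_arg_max (total_overlap N E \<circ> fst) (mip_feasible N E X M \<epsilon>)"

end

theory Submission
  imports Defs
begin

text \<open>
  Shortening a phase can only shrink the overlap, so over all admissible phases the overlap is least
  when both durations are minimal (\<open>worst_overlap_eq_shortest_phases\<close>). Hence the robust hypograph
  condition on \<open>\<sigma>\<close>, which quantifies over a continuum of phases, says just \<open>0 \<le> \<sigma> \<le> w\<close>, where \<open>w\<close> is
  the overlap of the two shortest phases (\<open>robust_hypograph_iff\<close>). For durations \<open>\<alpha>\<close> and \<open>\<beta>\<close> that
  overlap is the minimum of the four linear terms \<open>\<alpha>\<close>, \<open>\<beta>\<close>, \<open>d - a + \<alpha> + \<beta>\<close> and \<open>a - d\<close> as long as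
  \<open>d < a < d + \<alpha> + \<beta>\<close>, and \<open>0\<close> otherwise (\<open>overlap_of_durations\<close>).

  The binary variable chooses between the two cases. At \<open>lam = 1\<close> the first two constraints are the
  strict inequalities \<open>d < a < d + \<alpha> + \<beta>\<close>: on the time grid a strict inequality leaves a gap of at least
  one granule, so it survives the slack \<open>\<epsilon>\<close> (\<open>grid_slack\<close>). The other constraints then bound \<open>\<sigma>\<close> by the
  four terms. At \<open>lam = 0\<close> every constraint containing \<open>M\<close> is vacuous, because two event times differ by
  at most the horizon, and \<open>\<sigma> = 0\<close> is forced. A suitable \<open>lam\<close> therefore exists if and only if
  \<open>0 \<le> \<sigma> \<le> w\<close>, and it can be taken to indicate \<open>\<sigma> > 0\<close> (\<open>robust_formulation_iff\<close>).

  So the robust feasible set is the projection of the mixed-integer one, and since the objective does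
  not depend on \<open>lam\<close>, the optima correspond too. At an optimum each \<open>\<sigma>\<close> equals its bound \<open>w\<close>, since
  raising one of the finitely many \<open>\<sigma>\<close> to its bound keeps feasibility and increases the objective.
\<close>

section \<open>The least overlap over all admissible phases\<close>

lemma overlap_mono:
  assumes "dp \<le> dp'" "am' \<le> am" "d \<le> dp'" "am' \<le> a"
  shows "overlap d dp am a \<le> overlap d dp' am' a"
  using assms unfolding overlap_def by auto

text \<open>
  The maximum of \<open>d\<close> and \<open>a - \<beta>\<close> is subtracted from the minimum of \<open>d + \<alpha>\<close> and \<open>a\<close>; the four possible
  differences of these terms are the four terms below.
\<close>

lemma overlap_of_durations:
  assumes "0 \<le> \<alpha>" "0 \<le> \<beta>"
  shows "overlap d (d + \<alpha>) (a - \<beta>) a =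
    (if d < a \<and> a < d + \<alpha> + \<beta> then min (min \<alpha> \<beta>) (min (d - a + \<alpha> + \<beta>) (a - d)) else 0)"
  using assms unfolding overlap_def by (auto simp: min_def max_def)

definition valid_durations :: "('n, 't) railway \<Rightarrow> ('n, 't) event_pair \<Rightarrow> bool" where
  "valid_durations N = (\<lambda>(i, j, t, x).
     0 \<le> acc_lo N j x \<and> acc_lo N j x \<le> acc_up N j x \<and>
     0 \<le> brk_lo N i t \<and> brk_lo N i t \<le> brk_up N i t)"

lemma overlap_shortest_phases_le:
  assumes "valid_durations N (i, j, t, x)" and "(am, dp) \<in> phase_box N a d (i, j, t, x)"
  shows "overlap (d j x) (d j x + acc_lo N j x) (a i t - brk_lo N i t) (a i t)
    \<le> overlap (d j x) dp am (a i t)"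
  using assms unfolding valid_durations_def by (intro overlap_mono) auto

lemma shortest_phases_in_phase_box:
  assumes "valid_durations N (i, j, t, x)"
  shows "(a i t - brk_lo N i t, d j x + acc_lo N j x) \<in> phase_box N a d (i, j, t, x)"
  using assms unfolding valid_durations_def by auto

lemma worst_overlap_eq_shortest_phases:
  assumes "valid_durations N (i, j, t, x)"
  shows "worst_overlap N a d (i, j, t, x)
    = overlap (d j x) (d j x + acc_lo N j x) (a i t - brk_lo N i t) (a i t)"
  unfolding worst_overlap.simps
proof (rule cInf_eq_minimum)
  show "overlap (d j x) (d j x + acc_lo N j x) (a i t - brk_lo N i t) (a i t)
    \<in> (\<lambda>(am, dp). overlap (d j x) dp am (a i t)) ` phase_box N a d (i, j, t, x)"
    using shortest_phases_in_phase_box[OF assms] by (rule rev_image_eqI) simp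
next
  fix y
  assume "y \<in> (\<lambda>(am, dp). overlap (d j x) dp am (a i t)) ` phase_box N a d (i, j, t, x)"
  then show "overlap (d j x) (d j x + acc_lo N j x) (a i t - brk_lo N i t) (a i t) \<le> y"
    using overlap_shortest_phases_le[OF assms] by fast
qed

lemma worst_overlap_eq:
  assumes "valid_durations N (i, j, t, x)"
  shows "worst_overlap N a d (i, j, t, x) =
    (if d j x < a i t \<and> a i t < d j x + acc_lo N j x + brk_lo N i t
     then min (min (acc_lo N j x) (brk_lo N i t))
       (min (d j x - a i t + acc_lo N j x + brk_lo N i t) (a i t - d j x))
     else 0)"
  using assms
  unfolding worst_overlap_eq_shortest_phases[OF assms] valid_durations_def
  by (intro overlap_of_durations) auto

lemma worst_overlap_nonneg:
  assumes "valid_durations N e"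
  shows "0 \<le> worst_overlap N a d e"
proof -
  obtain i j t x where e: "e = (i, j, t, x)" by (cases e)
  show ?thesis
    using assms worst_overlap_eq[of N i j t x a d] unfolding e valid_durations_def by auto
qed

lemma robust_hypograph_iff:
  assumes "valid_durations N e"
  shows "robust_hypograph N a d e \<sigma> \<longleftrightarrow> 0 \<le> \<sigma> \<and> \<sigma> \<le> worst_overlap N a d e"
proof -
  obtain i j t x where e: "e = (i, j, t, x)" by (cases e)
  note valid = assms[unfolded e]
  show ?thesis
    unfolding e robust_hypograph.simps worst_overlap_eq_shortest_phases[OF valid]
    using overlap_shortest_phases_le[OF valid] shortest_phases_in_phase_box[OF valid]
    by (fastforce simp del: phase_box.simps)
qed

section \<open>The big-M constraints for one pair of events\<close>

lemma on_grid_add: "on_grid g x \<Longrightarrow> on_grid g y \<Longrightarrow> on_grid g (x + y)"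
  unfolding on_grid_def by (metis distrib_right of_int_add)

lemma on_grid_diff: "on_grid g x \<Longrightarrow> on_grid g y \<Longrightarrow> on_grid g (x - y)"
  unfolding on_grid_def by (metis left_diff_distrib of_int_diff)

text \<open>
  Two distinct multiples of \<open>g\<close> are at least \<open>g\<close> apart, so any slack below \<open>g\<close> fits in between.
\<close>

lemma grid_slack:
  assumes "on_grid g x" "on_grid g y" "0 < \<epsilon>" "\<epsilon> < g"
  shows "x + \<epsilon> \<le> y \<longleftrightarrow> x < y"
proof
  assume "x < y"
  obtain k l :: int where x: "x = of_int k * g" and y: "y = of_int l * g"
    using assms(1,2) unfolding on_grid_def by blast
  have "k < l"
    using \<open>x < y\<close> assms(3,4) unfolding x y by simp
  then have "of_int (k + 1) * g \<le> of_int l * g"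
    using assms(3,4) by (intro mult_right_mono) auto
  then show "x + \<epsilon> \<le> y"
    using assms(4) unfolding x y by (simp add: algebra_simps)
qed (use assms(3) in linarith)

definition valid_times ::
  "('n, 't) railway \<Rightarrow> ('n \<Rightarrow> 't \<Rightarrow> real) \<Rightarrow> ('n \<Rightarrow> 't \<Rightarrow> real) \<Rightarrow> ('n, 't) event_pair \<Rightarrow> bool" where
  "valid_times N a d = (\<lambda>(i, j, t, x).
     a i t \<in> {0..horizon N} \<and> d j x \<in> {0..horizon N} \<and>
     on_grid (granularity N) (a i t) \<and> on_grid (granularity N) (d j x) \<and>
     on_grid (granularity N) (acc_lo N j x) \<and> on_grid (granularity N) (brk_lo N i t))"

lemma robust_formulation_one_iff:
  assumes "valid_durations N (i, j, t, x)" and "valid_times N a d (i, j, t, x)"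
    and "0 < \<epsilon>" "\<epsilon> < granularity N"
  shows "robust_formulation N M \<epsilon> a d (i, j, t, x) \<sigma> 1 \<longleftrightarrow>
    d j x < a i t \<and> a i t < d j x + acc_lo N j x + brk_lo N i t \<and>
    0 \<le> \<sigma> \<and> \<sigma> \<le> worst_overlap N a d (i, j, t, x)"
proof -
  have grid: "on_grid (granularity N) (a i t)" "on_grid (granularity N) (d j x)"
    "on_grid (granularity N) (a i t - d j x)"
    "on_grid (granularity N) (acc_lo N j x + brk_lo N i t)"
    using assms(2) unfolding valid_times_def by (auto intro: on_grid_add on_grid_diff)
  have "d j x + \<epsilon> \<le> a i t \<longleftrightarrow> d j x < a i t"
    using grid assms(3,4) by (intro grid_slack)
  moreover have "a i t - d j x + \<epsilon> \<le> acc_lo N j x + brk_lo N i t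
      \<longleftrightarrow> a i t - d j x < acc_lo N j x + brk_lo N i t"
    using grid assms(3,4) by (intro grid_slack)
  ultimately show ?thesis
    unfolding worst_overlap_eq[OF assms(1)] by auto
qed

text \<open>
  In the constraints that contain \<open>M\<close>, the left-hand sides exceed the remaining right-hand sides by at
  most \<open>horizon N + \<epsilon>\<close>; the absolute value keeps the bound on \<open>M\<close> positive even for a railway
  with negative horizon, which has no pairs of events.
\<close>

lemma robust_formulation_zero_iff:
  assumes "valid_durations N (i, j, t, x)" and "valid_times N a d (i, j, t, x)"
    and "\<epsilon> < granularity N" "\<bar>horizon N\<bar> + granularity N \<le> M"
    and "0 < granularity N"
  shows "robust_formulation N M \<epsilon> a d (i, j, t, x) \<sigma> 0 \<longleftrightarrow> \<sigma> = 0"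
  using assms unfolding valid_durations_def valid_times_def by auto

text \<open>
  The indicating choice is \<open>lam = 1\<close> for \<open>\<sigma> > 0\<close>, where \<open>w > 0\<close> puts \<open>a\<close> strictly between \<open>d\<close> and
  \<open>d + \<alpha> + \<beta>\<close>, and \<open>lam = 0\<close> for \<open>\<sigma> = 0\<close>.
\<close>

lemma robust_formulation_iff:
  assumes valid: "valid_durations N e" "valid_times N a d e"
    and \<epsilon>: "0 < \<epsilon>" "\<epsilon> < granularity N" and M: "\<bar>horizon N\<bar> + granularity N \<le> M"
  shows "robust_hypograph N a d e \<sigma> \<longleftrightarrow> (\<exists>lam. robust_formulation N M \<epsilon> a d e \<sigma> lam)" (is "?H \<longleftrightarrow> ?F")
    and "robust_hypograph N a d e \<sigma> \<longleftrightarrow>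
      (\<exists>lam. robust_formulation N M \<epsilon> a d e \<sigma> lam \<and> (lam = 1 \<longleftrightarrow> 0 < \<sigma>))" (is "_ \<longleftrightarrow> ?I")
proof -
  obtain i j t x where e: "e = (i, j, t, x)" by (cases e)
  note one = robust_formulation_one_iff[OF valid[unfolded e] \<epsilon>]
  note zero = robust_formulation_zero_iff[OF valid[unfolded e] \<epsilon>(2) M less_trans[OF \<epsilon>]]
  note hypo = robust_hypograph_iff[OF valid(1)]
  have "?I" if ?H
  proof (cases "0 < \<sigma>")
    case True
    then have "0 < worst_overlap N a d (i, j, t, x)"
      using that unfolding hypo unfolding e by linarith
    then have "d j x < a i t \<and> a i t < d j x + acc_lo N j x + brk_lo N i t"
      unfolding worst_overlap_eq[OF valid(1)[unfolded e]] by (simp split: if_splits)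
    then have "robust_formulation N M \<epsilon> a d e \<sigma> 1"
      using that unfolding hypo unfolding e one by simp
    then show ?thesis using True by blast
  next
    case False
    then have "robust_formulation N M \<epsilon> a d e \<sigma> 0"
      using that unfolding hypo unfolding e zero by simp
    then show ?thesis using False by (intro exI[of _ 0]) simp
  qed
  moreover have "?H" if F: "robust_formulation N M \<epsilon> a d e \<sigma> lam" for lam
  proof -
    have "lam = 0 \<or> lam = 1" using F unfolding e by simp
    then show ?thesis
      using F worst_overlap_nonneg[OF valid(1), of a d] unfolding hypo unfolding e
      by (elim disjE) (simp_all only: one zero, simp)
  qed
  ultimately show "?H \<longleftrightarrow> ?F" "?H \<longleftrightarrow> ?I" by blast+
qed

section \<open>The pairs of events of a railway\<close>

lemma left_pairs_trains:
  assumes "wf_railway N" "closest_pairs N E" "(i, j, t, x) \<in> left_pairs N E"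
  shows "i \<in> platforms N" "j \<in> platforms N" "t \<in> trains_at N i" "x \<in> trains_at N j"
proof -
  have "(i, j) \<in> opposite N \<and> t \<in> trains_at N i"
    using assms(2,3) unfolding closest_pairs_def left_pairs_def by blast
  then show "i \<in> platforms N" "j \<in> platforms N" "t \<in> trains_at N i"
    using assms(1) unfolding wf_railway_def by auto
  show "x \<in> trains_at N j"
    using assms(3) unfolding left_pairs_def closest_left_def is_arg_min_def by blast
qed

lemma finite_left_pairs:
  assumes "wf_railway N" "closest_pairs N E"
  shows "finite (left_pairs N E)"
proof (rule finite_subset)
  show "left_pairs N E \<subseteq> platforms N \<times> platforms N \<times> trains N \<times> trains N"
  proof
    fix e assume "e \<in> left_pairs N E"
    moreover obtain i j t x where "e = (i, j, t, x)" by (cases e)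
    ultimately show "e \<in> platforms N \<times> platforms N \<times> trains N \<times> trains N"
      using assms(1) left_pairs_trains[OF assms, of i j t x] unfolding wf_railway_def by auto
  qed
  show "finite (platforms N \<times> platforms N \<times> trains N \<times> trains N)"
    using assms(1) unfolding wf_railway_def by simp
qed

lemma valid_durations_left_pairs:
  assumes "wf_railway N" "closest_pairs N E" "e \<in> left_pairs N E"
  shows "valid_durations N e"
proof -
  obtain i j t x where e: "e = (i, j, t, x)" by (cases e)
  show ?thesis
    using assms(1) left_pairs_trains[OF assms(1,2) assms(3)[unfolded e]]
    unfolding e valid_durations_def wf_railway_def by simp
qed

lemma valid_times_left_pairs:
  assumes "wf_railway N" "closest_pairs N E" "timetable_constraints N X"
    and "(a, d, \<rho>) \<in> X" "e \<in> left_pairs N E"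
  shows "valid_times N a d e"
proof -
  obtain i j t x where e: "e = (i, j, t, x)" by (cases e)
  have "\<forall>i \<in> platforms N. \<forall>t \<in> trains_at N i.
      a i t \<in> {0..horizon N} \<and> on_grid (granularity N) (a i t) \<and>
      d i t \<in> {0..horizon N} \<and> on_grid (granularity N) (d i t)"
    using assms(3,4) unfolding timetable_constraints_def by fast
  then show ?thesis
    using assms(1) left_pairs_trains[OF assms(1,2) assms(5)[unfolded e]]
    unfolding e valid_times_def wf_railway_def by simp
qed

section \<open>Optimal solutions\<close>

lemma is_arg_max_projection:
  assumes "\<And>s. P s \<longleftrightarrow> (\<exists>l. Q (s, l))"
  shows "is_arg_max f P s \<longleftrightarrow> (\<exists>l. is_arg_max (f \<circ> fst) Q (s, l))"
  using assms unfolding is_arg_max_def by auto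

text \<open>
  Finiteness is essential: over an infinite set the sum would be \<open>0\<close> whatever the summands are, and the
  objective would not push them up to their bounds.
\<close>

lemma robust_optimal_tight:
  assumes fin: "finite (left_pairs N E)"
    and valid: "\<And>e. e \<in> left_pairs N E \<Longrightarrow> valid_durations N e"
    and opt: "robust_optimal N E X ((a, d, \<rho>), \<sigma>)"
    and e: "e \<in> left_pairs N E"
  shows "\<sigma> e = worst_overlap N a d e"
proof (rule ccontr)
  assume neq: "\<sigma> e \<noteq> worst_overlap N a d e"
  define \<sigma>' where "\<sigma>' = \<sigma>(e := worst_overlap N a d e)"
  have feas: "robust_feasible N E X ((a, d, \<rho>), \<sigma>)"
    and max: "\<And>s. robust_feasible N E X s \<Longrightarrow> total_overlap N E s \<le> total_overlap N E ((a, d, \<rho>), \<sigma>)"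
    using opt unfolding robust_optimal_def is_arg_max_def by (auto simp: not_less)
  have bounds: "0 \<le> \<sigma> e'" "\<sigma> e' \<le> worst_overlap N a d e'" if "e' \<in> left_pairs N E" for e'
    using feas that robust_hypograph_iff[OF valid[OF that]] unfolding robust_feasible_def by auto
  have "robust_feasible N E X ((a, d, \<rho>), \<sigma>')"
    using feas bounds robust_hypograph_iff[OF valid] worst_overlap_nonneg[OF valid]
    unfolding robust_feasible_def \<sigma>'_def by auto
  then have "total_overlap N E ((a, d, \<rho>), \<sigma>') \<le> total_overlap N E ((a, d, \<rho>), \<sigma>)"
    by (rule max)
  moreover have "(\<Sum>e \<in> left_pairs N E. \<sigma> e) < (\<Sum>e \<in> left_pairs N E. \<sigma>' e)"
    using fin
  proof (rule sum_strict_mono_ex1)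
    show "\<forall>e' \<in> left_pairs N E. \<sigma> e' \<le> \<sigma>' e'"
      using bounds unfolding \<sigma>'_def by simp
    show "\<exists>e' \<in> left_pairs N E. \<sigma> e' < \<sigma>' e'"
      using e neq bounds(2)[OF e] unfolding \<sigma>'_def by (intro bexI[of _ e]) auto
  qed
  ultimately show False
    unfolding total_overlap_def by simp
qed

theorem lemma2:
  fixes N :: "('n, 't) railway"
    and E :: "('n, 't) event_pair set"
    and X :: "('n, 't) partial_solution set"
  assumes "wf_railway N"
    and "closest_pairs N E"
    and "timetable_constraints N X"
  shows "\<exists>M0 > 0. \<forall>M \<ge> M0. \<forall>\<epsilon>. 0 < \<epsilon> \<and> \<epsilon> < granularity N \<longrightarrow>
    (\<forall>(a, d, \<rho>) \<in> X. \<forall>e \<in> left_pairs N E. \<forall>\<sigma>.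
       (robust_hypograph N a d e \<sigma> \<longleftrightarrow> (\<exists>lam. robust_formulation N M \<epsilon> a d e \<sigma> lam)) \<and>
       (robust_hypograph N a d e \<sigma> \<longleftrightarrow>
          (\<exists>lam. robust_formulation N M \<epsilon> a d e \<sigma> lam \<and> (lam = 1 \<longleftrightarrow> 0 < \<sigma>)))) \<and>
    (\<forall>s. robust_optimal N E X s \<longleftrightarrow> (\<exists>lam. mip_optimal N E X M \<epsilon> (s, lam))) \<and>
    (\<forall>a d \<rho> \<sigma> lam. mip_optimal N E X M \<epsilon> (((a, d, \<rho>), \<sigma>), lam) \<longrightarrow>
       (\<forall>(i, j, t, x) \<in> left_pairs N E.
          \<sigma> (i, j, t, x) = worst_overlap N a d (i, j, t, x) \<and>
          (0 < acc_lo N j x \<and> 0 < brk_lo N i t \<longrightarrow>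
             (lam (i, j, t, x) = 1 \<longleftrightarrow> 0 < \<sigma> (i, j, t, x)))))"
proof -
  note wf = assms(1) and pairs = assms(2) and X = assms(3)
  have g: "0 < granularity N"
    using wf unfolding wf_railway_def by blast
  show ?thesis
  proof (rule exI[of _ "\<bar>horizon N\<bar> + granularity N"], intro conjI allI impI)
    show "0 < \<bar>horizon N\<bar> + granularity N"
      using g by linarith
  next
    fix M \<epsilon> :: real
    assume M: "\<bar>horizon N\<bar> + granularity N \<le> M" and "0 < \<epsilon> \<and> \<epsilon> < granularity N"
    then have \<epsilon>: "0 < \<epsilon>" "\<epsilon> < granularity N" by auto
    note durations = valid_durations_left_pairs[OF wf pairs]
    note times = valid_times_left_pairs[OF wf pairs X]
    note pointwise = robust_formulation_iff[OF durations times \<epsilon> M]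
    show "\<forall>(a, d, \<rho>) \<in> X. \<forall>e \<in> left_pairs N E. \<forall>\<sigma>.
       (robust_hypograph N a d e \<sigma> \<longleftrightarrow> (\<exists>lam. robust_formulation N M \<epsilon> a d e \<sigma> lam)) \<and>
       (robust_hypograph N a d e \<sigma> \<longleftrightarrow>
          (\<exists>lam. robust_formulation N M \<epsilon> a d e \<sigma> lam \<and> (lam = 1 \<longleftrightarrow> 0 < \<sigma>)))"
      using pointwise by blast
    have feasible: "robust_feasible N E X s \<longleftrightarrow> (\<exists>lam. mip_feasible N E X M \<epsilon> (s, lam))" for s
    proof -
      obtain a d \<rho> \<sigma> where s: "s = ((a, d, \<rho>), \<sigma>)" by (metis surj_pair)
      have "(\<forall>e \<in> left_pairs N E. robust_hypograph N a d e (\<sigma> e)) \<longleftrightarrow>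
          (\<exists>lam. \<forall>e \<in> left_pairs N E. robust_formulation N M \<epsilon> a d e (\<sigma> e) (lam e))"
        if "(a, d, \<rho>) \<in> X"
        using pointwise(1)[OF _ that] bchoice[of "left_pairs N E"] by meson
      then show ?thesis
        unfolding s robust_feasible_def mip_feasible_def by auto
    qed
    have optimal: "robust_optimal N E X s \<longleftrightarrow> (\<exists>lam. mip_optimal N E X M \<epsilon> (s, lam))" for s
      unfolding robust_optimal_def mip_optimal_def by (rule is_arg_max_projection[OF feasible])
    then show "robust_optimal N E X s \<longleftrightarrow> (\<exists>lam. mip_optimal N E X M \<epsilon> (s, lam))" for s .
    fix a d \<rho> \<sigma> lam
    assume opt: "mip_optimal N E X M \<epsilon> (((a, d, \<rho>), \<sigma>), lam)"
    have "(a, d, \<rho>) \<in> X"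
      and form: "\<And>e. e \<in> left_pairs N E \<Longrightarrow> robust_formulation N M \<epsilon> a d e (\<sigma> e) (lam e)"
      using opt unfolding mip_optimal_def is_arg_max_def mip_feasible_def by auto
    show "\<forall>(i, j, t, x) \<in> left_pairs N E.
          \<sigma> (i, j, t, x) = worst_overlap N a d (i, j, t, x) \<and>
          (0 < acc_lo N j x \<and> 0 < brk_lo N i t \<longrightarrow>
             (lam (i, j, t, x) = 1 \<longleftrightarrow> 0 < \<sigma> (i, j, t, x)))"
    proof clarify
      fix i j t x assume e: "(i, j, t, x) \<in> left_pairs N E"
      note valid = durations[OF e] times[OF \<open>(a, d, \<rho>) \<in> X\<close> e]
      note form_e = form[OF e]
      have tight: "\<sigma> (i, j, t, x) = worst_overlap N a d (i, j, t, x)"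
        using robust_optimal_tight[OF finite_left_pairs[OF wf pairs] durations _ e] opt optimal
        by blast
      moreover have "lam (i, j, t, x) = 1" if "0 < \<sigma> (i, j, t, x)"
        using form_e that by auto
      \<comment> \<open>With both durations positive, all four terms of the minimum are positive once \<open>a\<close> lies
          strictly between \<open>d\<close> and \<open>d + \<alpha> + \<beta>\<close>, so that \<open>lam = 1\<close> with \<open>\<sigma> = 0\<close> cannot be optimal.\<close>
      moreover have "0 < \<sigma> (i, j, t, x)"
        if pos: "0 < acc_lo N j x" "0 < brk_lo N i t" and one: "lam (i, j, t, x) = 1"
      proof -
        have "d j x < a i t \<and> a i t < d j x + acc_lo N j x + brk_lo N i t"
          using form_e robust_formulation_one_iff[OF valid \<epsilon>] unfolding one by blast
        then show ?thesis
          unfolding tight worst_overlap_eq[OF valid(1)] using pos by simp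
      qed
      ultimately show "\<sigma> (i, j, t, x) = worst_overlap N a d (i, j, t, x) \<and>
          (0 < acc_lo N j x \<and> 0 < brk_lo N i t \<longrightarrow>
             (lam (i, j, t, x) = 1 \<longleftrightarrow> 0 < \<sigma> (i, j, t, x)))"
        by blast
    qed
  qed
qed

end
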